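(* Let $P=[I_3\mid \mathbf 0]$, $P'=[A\mid a_4]$, $P''=[B\mid b_4]$ be a non-degenerate canonical three-view camera system with $A,B\in\mathbb R^{3\times3}$, $a_4,b_4\in\mathbb R^3$, let $\mathcal T=(T_{ijk})$, $T_{ijk}=a_{ji}b_{k4}-a_{j4}b_{ki}$, be its trifocal tensor, and let $e'=a_4$, $e''=b_4$ be the epipoles. Then: 1. $\mathcal T\ast_{(1,3)}I_3=Ae''-(\operatorname{tr}B)\,e'$; 2. $\mathcal T\ast_{(2,3)}I_3=A^{\top}e''-B^{\top}e'$; 3. $\mathcal T\ast_{(1,2)}I_3=(\operatorname{tr}A)\,e''-Be'$.
   Context: Notation: $a_{ji}=A_{ji}$, $b_{ki}=B_{ki}$, and $a_{j4},b_{k4}$ are the components of $a_4,b_4$. The double contraction $\mathcal T\ast_{(p,q)}I_3\in\mathbb R^3$ contracts modes $p$ and $q$ of $\mathcal T$ with the two modes of the identity matrix: $(\mathcal T\ast_{(1,3)}I_3)_j=\sum_{i,k}T_{ijk}\delta_{ik}$, $(\mathcal T\ast_{(2,3)}I_3)_i=\sum_{j,k}T_{ijk}\delta_{jk}$, $(\mathcal T\ast_{(1,2)}I_3)_k=\sum_{i,j}T_{ijk}\delta_{ij}$. The system is non-degenerate if $A,B$ are invertible and the camera centers $0,-A^{-1}a_4,-B^{-1}b_4$ are not collinear. *)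

theory Defs
  imports "HOL-Analysis.Analysis"
begin

text \<open>
  The library's \<open>vector [x1, ..., xn]\<close> places its entries at the indices \<open>1, ..., n\<close>.
\<close>

definition camera_matrix :: "real^3^3 \<Rightarrow> real^3 \<Rightarrow> real^4^3" where
  "camera_matrix M m = (\<chi> r. vector [M $ r $ 1, M $ r $ 2, M $ r $ 3, m $ r])"

definition left_block :: "real^4^3 \<Rightarrow> real^3^3" where
  "left_block P = (\<chi> r. vector [P $ r $ 1, P $ r $ 2, P $ r $ 3])"

lemma left_block_camera_matrix [simp]: "left_block (camera_matrix M m) = M"
  by (simp add: left_block_def camera_matrix_def vec_eq_iff forall_3 vector_def)

lemma column_4_camera_matrix [simp]: "column 4 (camera_matrix M m) = m"
  by (simp add: column_def camera_matrix_def vec_eq_iff forall_3 vector_def)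

text \<open>
  For \<open>P = [M | m]\<close> with \<open>M\<close> invertible, the affine point \<open>c\<close> with \<open>M c + m = 0\<close>.
\<close>

definition camera_center :: "real^4^3 \<Rightarrow> real^3" where
  "camera_center P = - (matrix_inv (left_block P) *v column 4 P)"

definition nondegenerate :: "real^4^3 \<Rightarrow> real^4^3 \<Rightarrow> real^4^3 \<Rightarrow> bool" where
  "nondegenerate P P' P'' \<longleftrightarrow>
     invertible (left_block P') \<and> invertible (left_block P'') \<and>
     \<not> collinear {camera_center P, camera_center P', camera_center P''}"

lemma nondegenerate_canonical:
  "nondegenerate (camera_matrix (mat 1) 0) (camera_matrix A a4) (camera_matrix B b4) \<longleftrightarrow>
     invertible A \<and> invertible B \<and>
     \<not> collinear {0, - (matrix_inv A *v a4), - (matrix_inv B *v b4)}"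
  by (simp add: nondegenerate_def camera_center_def)

text \<open>
  The trifocal tensor of the canonical system \<open>[I | 0], P', P''\<close>. The entry \<open>T\<^sub>i\<^sub>j\<^sub>k\<close> is
  \<open>T $ i $ j $ k\<close>.
\<close>

definition trifocal_tensor :: "real^4^3 \<Rightarrow> real^4^3 \<Rightarrow> real^3^3^3" where
  "trifocal_tensor P' P'' = (\<chi> i j k.
     left_block P' $ j $ i * column 4 P'' $ k - column 4 P' $ j * left_block P'' $ k $ i)"

text \<open>
  \<open>contract_pq T M\<close> contracts mode \<open>p\<close> of \<open>T\<close> with the first mode of \<open>M\<close> and mode \<open>q\<close> of \<open>T\<close>
  with the second mode of \<open>M\<close>.
\<close>

definition contract_13 :: "real^3^3^3 \<Rightarrow> real^3^3 \<Rightarrow> real^3" where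
  "contract_13 T M = (\<chi> j. \<Sum>i\<in>UNIV. \<Sum>k\<in>UNIV. T $ i $ j $ k * M $ i $ k)"

definition contract_23 :: "real^3^3^3 \<Rightarrow> real^3^3 \<Rightarrow> real^3" where
  "contract_23 T M = (\<chi> i. \<Sum>j\<in>UNIV. \<Sum>k\<in>UNIV. T $ i $ j $ k * M $ j $ k)"

definition contract_12 :: "real^3^3^3 \<Rightarrow> real^3^3 \<Rightarrow> real^3" where
  "contract_12 T M = (\<chi> k. \<Sum>i\<in>UNIV. \<Sum>j\<in>UNIV. T $ i $ j $ k * M $ i $ j)"

end

theory Submission
  imports Defs
begin

text \<open>
  Contracting two modes with the identity matrix puts their indices equal and sums over the
  common value. Each entry \<open>T\<^sub>i\<^sub>j\<^sub>k = a\<^sub>j\<^sub>i b\<^sub>k\<^sub>4 - a\<^sub>j\<^sub>4 b\<^sub>k\<^sub>i\<close> is a difference of two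
  products, each a matrix entry times an entry of an epipole, and the matrix always carries the
  mode \<open>i\<close>. A product whose matrix has both indices identified
  contributes a trace times the epipole. If the identified modes are shared between the matrix and
  the epipole, the sum is a matrix-vector product: it is formed with the matrix itself when \<open>i\<close>
  is summed, and with its transpose when \<open>i\<close> survives.
  The three formulas are the three choices of the identified pair.
\<close>

lemma contract_13_mat_1: "contract_13 T (mat 1) $ j = (\<Sum>i\<in>UNIV. T $ i $ j $ i)"
  by (simp add: contract_13_def mat_def if_distrib cong: if_cong)

lemma contract_23_mat_1: "contract_23 T (mat 1) $ i = (\<Sum>j\<in>UNIV. T $ i $ j $ j)"
  by (simp add: contract_23_def mat_def if_distrib cong: if_cong)

lemma contract_12_mat_1: "contract_12 T (mat 1) $ k = (\<Sum>i\<in>UNIV. T $ i $ i $ k)"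
  by (simp add: contract_12_def mat_def if_distrib cong: if_cong)

lemma trifocal_tensor_camera_matrix_nth:
  "trifocal_tensor (camera_matrix A a) (camera_matrix B b) $ i $ j $ k
     = A $ j $ i * b $ k - a $ j * B $ k $ i"
  by (simp add: trifocal_tensor_def)

lemma contract_13_trifocal_tensor:
  "contract_13 (trifocal_tensor (camera_matrix A a) (camera_matrix B b)) (mat 1)
     = A *v b - trace B *\<^sub>R a"
  by (simp add: vec_eq_iff contract_13_mat_1 trifocal_tensor_camera_matrix_nth
      matrix_vector_mult_def trace_def sum_subtractf sum_distrib_left mult.commute)

lemma contract_23_trifocal_tensor:
  "contract_23 (trifocal_tensor (camera_matrix A a) (camera_matrix B b)) (mat 1)
     = transpose A *v b - transpose B *v a"
  by (simp add: vec_eq_iff contract_23_mat_1 trifocal_tensor_camera_matrix_nth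
      matrix_vector_mult_def transpose_def sum_subtractf mult.commute)

lemma contract_12_trifocal_tensor:
  "contract_12 (trifocal_tensor (camera_matrix A a) (camera_matrix B b)) (mat 1)
     = trace A *\<^sub>R b - B *v a"
  by (simp add: vec_eq_iff contract_12_mat_1 trifocal_tensor_camera_matrix_nth
      matrix_vector_mult_def trace_def sum_subtractf sum_distrib_left mult.commute)

theorem theorem4p26:
  fixes P P' P'' :: "real^4^3"
    and A B :: "real^3^3"
    and a4 b4 e' e'' :: "real^3"
    and T :: "real^3^3^3"
  assumes "P = camera_matrix (mat 1) 0"
    and "P' = camera_matrix A a4"
    and "P'' = camera_matrix B b4"
    and "nondegenerate P P' P''"
    and "T = trifocal_tensor P' P''"
    and "e' = a4"
    and "e'' = b4"
  shows "contract_13 T (mat 1) = A *v e'' - trace B *\<^sub>R e'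
       \<and> contract_23 T (mat 1) = transpose A *v e'' - transpose B *v e'
       \<and> contract_12 T (mat 1) = trace A *\<^sub>R e'' - B *v e'"
  using assms by (simp add: contract_13_trifocal_tensor contract_23_trifocal_tensor
      contract_12_trifocal_tensor)

end
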